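(* Let $\mathcal X,\mathcal Y$ be complex separable Hilbert spaces, let $A\in\mathcal B(\mathcal X)$ and $B\in\mathcal B(\mathcal Y,\mathcal X)$, and assume that the row operator $(A\ B)\in\mathcal B(\mathcal X\oplus\mathcal Y,\mathcal X)$ is right invertible. Then $\mathcal X$ admits the decomposition $$\mathcal X=(\mathcal R(A)^\perp\dot+\mathcal R(B)^\perp)\oplus\bigl(\overline{\mathcal R(A)}\cap\overline{\mathcal R(B)}\bigr)\qquad(\ast)$$ and $\mathcal X\oplus\mathcal Y$ admits the decomposition $$\mathcal X\oplus\mathcal Y=\mathcal X_1\oplus\mathcal X_2\oplus\mathcal X_3\oplus\mathcal Y_3\oplus\mathcal Y_2\oplus\mathcal Y_1,\qquad(\ast\ast)$$ where $$\mathcal X_1:=\mathcal N(A),\quad\mathcal X_2:=\mathcal N(A)^\perp\ominus\mathcal N(P_{\mathcal R(B)^\perp}A)^\perp,\quad\mathcal X_3:=\mathcal N(P_{\mathcal R(B)^\perp}A)^\perp,$$ $$\mathcal Y_1:=\mathcal N(B),\quad\mathcal Y_2:=\mathcal N(B)^\perp\ominus\mathcal N(P_{\mathcal R(A)^\perp}B)^\perp,\quad\mathcal Y_3:=\mathcal N(P_{\mathcal R(A)^\perp}B)^\perp.$$ The row operator $(A\ B)$ from $\mathcal X\oplus\mathcal Y$ into $\mathcal X$ admits the following representation with respect to the decompositions $(\ast)$ and $(\ast\ast)$: $$\begin{pmatrix}0&0&0&B_3&0&0\\ 0&0&A_3&0&0&0\\ 0&A_2&A_0&B_0&B_2&0\end{pmatrix},$$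 where $A_0\in\mathcal B(\mathcal X_3,\overline{\mathcal R(A)}\cap\overline{\mathcal R(B)})$, $A_2\in\mathcal B(\mathcal X_2,\overline{\mathcal R(A)}\cap\overline{\mathcal R(B)})$, $A_3\in\mathcal B(\mathcal X_3,\mathcal R(B)^\perp)$, $B_0\in\mathcal B(\mathcal Y_3,\overline{\mathcal R(A)}\cap\overline{\mathcal R(B)})$, $B_2\in\mathcal B(\mathcal Y_2,\overline{\mathcal R(A)}\cap\overline{\mathcal R(B)})$, $B_3\in\mathcal B(\mathcal Y_3,\mathcal R(A)^\perp)$. Then the operators $A_3$ and $B_3$ are isomorphisms, the row operator $(A_2\ B_2):\mathcal X_2\oplus\mathcal Y_2\to\overline{\mathcal R(A)}\cap\overline{\mathcal R(B)}$ is right invertible, and $$\overline{\mathcal R(A_2)}=\overline{\mathcal R(A)}\cap\overline{\mathcal R(B)}=\overline{\mathcal R(B_2)}.$$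
   Context: $\mathcal B(\mathcal X,\mathcal Y)$ denotes the bounded linear operators from $\mathcal X$ to $\mathcal Y$, and $\mathcal B(\mathcal X)=\mathcal B(\mathcal X,\mathcal X)$. $\mathcal R(T)$ and $\mathcal N(T)$ denote range and kernel of $T$. An isomorphism is a linear bijection that is bounded with bounded inverse. $T\in\mathcal B(\mathcal X,\mathcal Y)$ is right invertible if there is $S\in\mathcal B(\mathcal Y,\mathcal X)$ with $TS=I_{\mathcal Y}$. $P_\Omega$ is the orthogonal projection onto a closed subspace $\Omega$. The symbol $\oplus$ denotes the orthogonal sum of closed subspaces, $\dot+$ the (not necessarily orthogonal) direct sum of subspaces, and for closed subspaces $\Omega_1\subset\Omega$, $\Omega\ominus\Omega_1$ is the orthogonal complement of $\Omega_1$ in $\Omega$. The row operator is $(A\ B)\binom{x}{y}=Ax+By$. In the block representation the columns correspond, in order, to $\mathcal X_1,\mathcal X_2,\mathcal X_3,\mathcal Y_3,\mathcal Y_2,\mathcal Y_1$ and the rows, in order, to $\mathcal R(A)^\perp$, $\mathcal R(B)^\perp$, $\overline{\mathcal R(A)}\cap\overline{\mathcal R(B)}$.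
   Formalization: The rows of the block matrix are read as orthogonal projections onto R(A)^⊥, R(B)^⊥ and the intersection of the closures, not as components in the direct decomposition (∗), for which the stated zero pattern fails when R(A)^⊥ and R(B)^⊥ are not orthogonal. *)

theory Defs
  imports "HOL-Analysis.Analysis" "HOL-Library.Set_Algebras"
begin

text \<open>
  A complex inner product space is
  introduced as a real one (which supplies norm and topology) together with a compatible complex
  scalar multiplication and a sesquilinear form, linear in its first argument, whose real part is
  the real inner product. In particular norm x ^ 2 = Re (cinner x x).
\<close>

class complex_vector = real_vector +
  fixes scaleC :: "complex \<Rightarrow> 'a \<Rightarrow> 'a" (infixr "*\<^sub>C" 75)
  assumes scaleC_add_right: "c *\<^sub>C (x + y) = c *\<^sub>C x + c *\<^sub>C y"
    and scaleC_add_left: "(c + d) *\<^sub>C x = c *\<^sub>C x + d *\<^sub>C x"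
    and scaleC_scaleC: "c *\<^sub>C d *\<^sub>C x = (c * d) *\<^sub>C x"
    and scaleC_one: "1 *\<^sub>C x = x"
    and scaleR_scaleC: "r *\<^sub>R x = complex_of_real r *\<^sub>C x"

interpretation complex_vector: vector_space "scaleC :: complex \<Rightarrow> 'a \<Rightarrow> 'a::complex_vector"
  by unfold_locales (simp_all add: scaleC_add_right scaleC_add_left scaleC_scaleC scaleC_one)

abbreviation csubspace :: "'a::complex_vector set \<Rightarrow> bool"
  where "csubspace \<equiv> complex_vector.subspace"

class complex_inner = complex_vector + real_inner +
  fixes cinner :: "'a \<Rightarrow> 'a \<Rightarrow> complex"
  assumes cinner_commute: "cinner x y = cnj (cinner y x)"
    and cinner_add_left: "cinner (x + y) z = cinner x z + cinner y z"
    and cinner_scaleC_left: "cinner (c *\<^sub>C x) y = c * cinner x y"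
    and inner_eq_Re_cinner: "inner x y = Re (cinner x y)"

class chilbert_space = complex_inner + complete_space

text \<open>The Hilbert space sum of two spaces is the product type.\<close>

instantiation prod :: (complex_vector, complex_vector) complex_vector
begin

definition scaleC_prod_def: "c *\<^sub>C p = (c *\<^sub>C fst p, c *\<^sub>C snd p)"

instance
  by standard
    (simp_all add: scaleC_prod_def scaleC_add_right scaleC_add_left scaleC_scaleC scaleC_one
      scaleR_prod_def scaleR_scaleC)

end

instantiation prod :: (complex_inner, complex_inner) complex_inner
begin

definition cinner_prod_def: "cinner p q = cinner (fst p) (fst q) + cinner (snd p) (snd q)"

instance
proof
  fix x y z :: "'a \<times> 'b" and c :: complex
  show "cinner x y = cnj (cinner y x)"
    unfolding cinner_prod_def complex_cnj_add
    by (simp add: cinner_commute[symmetric])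
  show "cinner (x + y) z = cinner x z + cinner y z"
    by (simp add: cinner_prod_def cinner_add_left)
  show "cinner (c *\<^sub>C x) y = c * cinner x y"
    by (simp add: cinner_prod_def scaleC_prod_def cinner_scaleC_left distrib_left)
  show "inner x y = Re (cinner x y)"
    by (simp add: cinner_prod_def inner_prod_def inner_eq_Re_cinner)
qed

end

instance prod :: (chilbert_space, chilbert_space) chilbert_space ..

definition perp :: "'a::complex_inner set \<Rightarrow> 'a set"
  where "perp S = {x. \<forall>y\<in>S. cinner x y = 0}"

definition ominus :: "'a::complex_inner set \<Rightarrow> 'a set \<Rightarrow> 'a set"  (infixl "\<ominus>" 65)
  where "S \<ominus> T = S \<inter> perp T"

text \<open>Orthogonal projection; meaningful when S is a closed subspace.\<close>

definition proj :: "'a::complex_inner set \<Rightarrow> 'a \<Rightarrow> 'a"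
  where "proj S x = (THE y. y \<in> S \<and> x - y \<in> perp S)"

text \<open>In the sums below, addition of sets is elementwise addition and the empty sum is {0}.\<close>

definition direct_sum :: "'a::complex_vector set \<Rightarrow> 'a set \<Rightarrow> 'a set \<Rightarrow> bool"
  where "direct_sum V S T \<longleftrightarrow> csubspace S \<and> csubspace T \<and> S \<inter> T = {0} \<and> V = S + T"

definition orthogonal_sum :: "'a::complex_inner set \<Rightarrow> 'a set list \<Rightarrow> bool"
  where "orthogonal_sum V Ss \<longleftrightarrow>
    (\<forall>S\<in>set Ss. csubspace S \<and> closed S) \<and>
    sorted_wrt (\<lambda>S T. \<forall>x\<in>S. \<forall>y\<in>T. cinner x y = 0) Ss \<and>
    V = sum_list Ss"

text \<open>
  An operator between subspaces S and T is a function on the ambient type of which only the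
  values on S matter.
\<close>

definition bounded_ops :: "'a::complex_inner set \<Rightarrow> 'b::complex_inner set \<Rightarrow> ('a \<Rightarrow> 'b) set"
  where "bounded_ops S T = {f. f ` S \<subseteq> T \<and>
    (\<forall>x\<in>S. \<forall>y\<in>S. f (x + y) = f x + f y) \<and>
    (\<forall>c. \<forall>x\<in>S. f (c *\<^sub>C x) = c *\<^sub>C f x) \<and>
    (\<exists>K. \<forall>x\<in>S. norm (f x) \<le> K * norm x)}"

definition isomorphism_on ::
    "'a::complex_inner set \<Rightarrow> 'b::complex_inner set \<Rightarrow> ('a \<Rightarrow> 'b) \<Rightarrow> bool"
  where "isomorphism_on S T f \<longleftrightarrow>
    f \<in> bounded_ops S T \<and> bij_betw f S T \<and> inv_into S f \<in> bounded_ops T S"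

definition right_invertible_on ::
    "'a::complex_inner set \<Rightarrow> 'b::complex_inner set \<Rightarrow> ('a \<Rightarrow> 'b) \<Rightarrow> bool"
  where "right_invertible_on S T f \<longleftrightarrow>
    f \<in> bounded_ops S T \<and> (\<exists>g \<in> bounded_ops T S. \<forall>y\<in>T. f (g y) = y)"

definition kernel :: "('a \<Rightarrow> 'b::zero) \<Rightarrow> 'a set"
  where "kernel f = {x. f x = 0}"

definition row_op :: "('a \<Rightarrow> 'c::plus) \<Rightarrow> ('b \<Rightarrow> 'c) \<Rightarrow> 'a \<times> 'b \<Rightarrow> 'c"
  where "row_op A B = (\<lambda>(x, y). A x + B y)"

text \<open>
  The matrix M (a list of rows) represents T with respect to the column spaces Ss and the row
  spaces Ws: its entry in row i and column j is a bounded operator from Ss ! j to Ws ! i, and for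
  every x which is the sum of components x j in Ss ! j, the matrix maps the column of these
  components to the column of the orthogonal projections of T x onto the row spaces.

  The row spaces need not be pairwise orthogonal, so these projections are in general not the
  summands of T x in a direct decomposition into the row spaces. If the row spaces span the
  whole space, they nevertheless determine T x.
\<close>

definition represents ::
    "('a::complex_inner \<Rightarrow> 'b::complex_inner) \<Rightarrow> 'a set list \<Rightarrow> 'b set list \<Rightarrow>
      ('a \<Rightarrow> 'b) list list \<Rightarrow> bool"
  where "represents T Ss Ws M \<longleftrightarrow>
    length M = length Ws \<and> (\<forall>i<length Ws. length (M ! i) = length Ss) \<and>
    (\<forall>i<length Ws. \<forall>j<length Ss. M ! i ! j \<in> bounded_ops (Ss ! j) (Ws ! i)) \<and>
    (\<forall>x. (\<forall>j<length Ss. x j \<in> Ss ! j) \<longrightarrow>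
      (\<forall>i<length Ws.
        proj (Ws ! i) (T (\<Sum>j<length Ss. x j)) = (\<Sum>j<length Ss. (M ! i ! j) (x j))))"

end

theory Submission
  imports Defs
begin

text \<open>
  Let \<open>C\<close> and \<open>D\<close> be the components of a right inverse, so that \<open>A C + B D = I\<close>, let \<open>Q\<close> be the
  projection onto \<open>R(B)\<^sup>\<bottom>\<close>, and let \<open>K = N(Q A)\<close>, which is the preimage of the closure of \<open>R(B)\<close>
  under \<open>A\<close>. Since \<open>Q B = 0\<close>, we have \<open>Q A C = Q\<close>. Hence \<open>C\<close> followed by the projection onto
  \<open>K\<^sup>\<bottom>\<close> inverts \<open>A\<^sub>3\<close>, and \<open>C\<close> maps \<open>M = cl R(A) \<inter> cl R(B)\<close> into \<open>K\<close>, which yields the right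
  inverse of \<open>(A\<^sub>2 B\<^sub>2)\<close>. If \<open>A x\<^sub>n\<close> converges to a point of \<open>M\<close>, then so does the image under \<open>A\<close>
  of \<open>x\<^sub>n - C Q A x\<^sub>n \<in> K\<close>, which gives the density of \<open>R(A\<^sub>2)\<close>. Finally,
  \<open>\<parallel>u\<parallel>\<^sup>2 = \<langle>u + v, A C u\<rangle>\<close> for \<open>u \<in> R(B)\<^sup>\<bottom>\<close> and \<open>v \<in> R(A)\<^sup>\<bottom>\<close>, so the sum of these two spaces is
  direct and closed.
\<close>

section \<open>Complex inner product spaces and orthogonal projections\<close>

lemma cinner_add_right: "cinner x (y + z) = cinner x y + cinner x z"
  by (metis cinner_add_left cinner_commute complex_cnj_add)

lemma cinner_scaleC_right: "cinner x (c *\<^sub>C y) = cnj c * cinner x y"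
  by (metis cinner_commute cinner_scaleC_left complex_cnj_mult)

lemma cinner_zero_left [simp]: "cinner 0 y = 0"
  using cinner_add_left[of 0 0 y] by simp

lemma cinner_zero_right [simp]: "cinner x 0 = 0"
  using cinner_add_right[of x 0 0] by simp

lemma Im_cinner: "Im (cinner x y) = inner x (\<i> *\<^sub>C y)"
  by (simp add: inner_eq_Re_cinner cinner_scaleC_right)

text \<open>Norm, topology and minimisation see only the real inner product. The split into real and
  imaginary part lets them reach complex orthogonality.\<close>

lemma cinner_eq_0_iff: "cinner x y = 0 \<longleftrightarrow> inner x y = 0 \<and> inner x (\<i> *\<^sub>C y) = 0"
  by (simp add: complex_eq_iff Im_cinner inner_eq_Re_cinner)

lemma cinner_self_eq_0 [simp]: "cinner x x = 0 \<longleftrightarrow> x = 0"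
  by (metis cinner_zero_left inner_eq_zero_iff inner_eq_Re_cinner zero_complex.sel(1))

lemma cinner_eq_0_commute: "cinner x y = 0 \<longleftrightarrow> cinner y x = 0"
  by (metis cinner_commute complex_cnj_zero)

lemma inner_perp: "x \<in> perp S \<Longrightarrow> y \<in> S \<Longrightarrow> inner x y = 0"
  by (simp add: perp_def inner_eq_Re_cinner)

lemma norm_scaleC: "norm (c *\<^sub>C x) = cmod c * norm (x :: 'a::complex_inner)"
proof -
  \<comment> \<open>\<open>cinner z z\<close> equals its own conjugate and is therefore real; its
    real part is the squared norm.\<close>
  have norm_sq: "complex_of_real ((norm z)\<^sup>2) = cinner z z" for z :: 'a
    by (metis Reals_cnj_iff cinner_commute inner_eq_Re_cinner of_real_Re power2_norm_eq_inner)
  have "complex_of_real ((norm (c *\<^sub>C x))\<^sup>2) = complex_of_real ((cmod c * norm x)\<^sup>2)"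
    unfolding norm_sq power_mult_distrib of_real_mult
    by (simp only: cinner_scaleC_left cinner_scaleC_right norm_sq complex_norm_square
        of_real_power[symmetric] mult_ac)
  then show ?thesis
    by (simp only: of_real_eq_iff) (simp add: power2_eq_iff_nonneg)
qed

lemma bounded_linear_scaleC: "bounded_linear (scaleC c :: 'a \<Rightarrow> 'a::complex_inner)"
  by (rule bounded_linear_intro[of _ "cmod c"])
    (simp_all add: scaleC_add_right scaleR_scaleC scaleC_scaleC norm_scaleC mult.commute)

lemma csubspace_imp_subspace: "csubspace S \<Longrightarrow> subspace S"
  by (simp add: subspace_def complex_vector.subspace_def scaleR_scaleC)

lemma csubspace_perp: "csubspace (perp S)"
  by (auto simp: complex_vector.subspace_def perp_def cinner_add_left cinner_scaleC_left)

lemma closed_perp: "closed (perp S)"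
proof -
  have "perp S = (\<Inter>y\<in>S. {x. inner x y = 0} \<inter> {x. inner x (\<i> *\<^sub>C y) = 0})"
    by (auto simp: perp_def cinner_eq_0_iff)
  then show ?thesis
    by (simp only:) (intro closed_INT ballI closed_Int closed_Collect_eq continuous_intros)
qed

lemma perp_Int_eq_0: "x \<in> S \<Longrightarrow> x \<in> perp S \<Longrightarrow> x = 0"
  by (auto simp: perp_def)

lemma subset_perp_perp: "S \<subseteq> perp (perp S)"
  by (auto simp: perp_def cinner_eq_0_commute)

lemma perp_antimono: "S \<subseteq> T \<Longrightarrow> perp T \<subseteq> perp S"
  by (auto simp: perp_def)

section \<open>Closest points and existence of orthogonal projections\<close>

lemma parallelogram:
  fixes a b :: "'a::real_inner"
  shows "(norm (a - b))\<^sup>2 = 2 * (norm a)\<^sup>2 + 2 * (norm b)\<^sup>2 - (norm (a + b))\<^sup>2"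
  by (simp add: power2_norm_eq_inner algebra_simps inner_commute)

lemma closest_point_imp_orthogonal:
  fixes e z :: "'a::real_inner"
  assumes "\<And>t. norm e \<le> norm (e - t *\<^sub>R z)"
  shows "inner e z = 0"
proof (cases "z = 0")
  case False
  \<comment> \<open>This \<open>t\<close> minimises the norm of \<open>e - t *\<^sub>R z\<close>;
    the squared norm drops there by \<open>inner e z * inner e z / inner z z\<close>, which the
    assumption forces to be at most 0.\<close>
  define t where "t = inner e z / inner z z"
  have "inner e e \<le> inner (e - t *\<^sub>R z) (e - t *\<^sub>R z)"
    using assms[of t] by (simp add: norm_le)
  also have "\<dots> = inner e e - 2 * t * inner e z + t * (t * inner z z)"
    by (simp add: algebra_simps inner_commute)
  also have "t * inner z z = inner e z"
    using False by (simp add: t_def)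
  finally have "inner e z * inner e z / inner z z \<le> 0"
    by (simp add: t_def)
  moreover have "inner z z > 0" using False by simp
  ultimately have "inner e z * inner e z \<le> 0"
    by (simp add: divide_le_0_iff)
  then show ?thesis
    using mult_eq_0_iff[of "inner e z" "inner e z"] zero_le_square[of "inner e z"] by linarith
qed simp

text \<open>A minimising sequence is Cauchy by the parallelogram law, because midpoints stay in
  \<open>S\<close>. Completeness gives a limit and closedness puts it into \<open>S\<close>.\<close>

lemma closed_subspace_closest_point:
  fixes S :: "'a::{real_inner, complete_space} set"
  assumes S: "subspace S" "closed S"
  obtains y where "y \<in> S" "\<And>z. z \<in> S \<Longrightarrow> norm (x - y) \<le> norm (x - z)"
proof -
  define d where "d = Inf ((\<lambda>z. (norm (x - z))\<^sup>2) ` S)"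
  have bdd: "bdd_below ((\<lambda>z. (norm (x - z))\<^sup>2) ` S)"
    by (rule bdd_belowI[of _ 0]) auto
  have ne: "S \<noteq> {}" using S(1) subspace_0 by auto
  have dle: "d \<le> (norm (x - z))\<^sup>2" if "z \<in> S" for z
    unfolding d_def using bdd that by (simp add: cInf_lower)
  have "\<exists>z\<in>S. (norm (x - z))\<^sup>2 < d + inverse (real (Suc n))" for n
    using cInf_lessD[of "(\<lambda>z. (norm (x - z))\<^sup>2) ` S" "d + inverse (real (Suc n))"] ne
    unfolding d_def by auto
  then obtain f where fS: "\<And>n. f n \<in> S"
    and f: "\<And>n. (norm (x - f n))\<^sup>2 < d + inverse (real (Suc n))"
    by metis
  have close: "(dist (f m) (f n))\<^sup>2 \<le> 2 * inverse (real (Suc m)) + 2 * inverse (real (Suc n))" for m n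
  proof -
    have "(1/2) *\<^sub>R (f m + f n) \<in> S"
      using fS S(1) by (simp add: subspace_add subspace_scale)
    \<comment> \<open>The midpoint has squared distance at least \<open>d\<close> from
      \<open>x\<close>. Doubling the vector gives \<open>4 * d\<close>, which cancels the
      contribution \<open>2 * d + 2 * d\<close> of the two points in the parallelogram law.\<close>
    then have "4 * d \<le> (norm (2 *\<^sub>R (x - (1/2) *\<^sub>R (f m + f n))))\<^sup>2"
      using dle by (simp add: power_mult_distrib)
    also have "2 *\<^sub>R (x - (1/2) *\<^sub>R (f m + f n)) = (x - f m) + (x - f n)"
      by (simp add: algebra_simps scaleR_2)
    finally show ?thesis
      using parallelogram[of "x - f m" "x - f n"] f[of m] f[of n]
      by (simp add: dist_norm norm_minus_commute)
  qed
  have "Cauchy f"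
  proof (rule metric_CauchyI)
    fix e :: real assume e: "0 < e"
    \<comment> \<open>A quarter of \<open>e\<^sup>2\<close> suffices, as the bound in
      \<open>close\<close> has two terms, each with factor 2.\<close>
    then obtain N where N: "inverse (real (Suc N)) < e\<^sup>2 / 4"
      using reals_Archimedean[of "e\<^sup>2 / 4"] by auto
    have "dist (f m) (f n) < e" if "m \<ge> N" "n \<ge> N" for m n
    proof -
      have "inverse (real (Suc m)) \<le> inverse (real (Suc N))"
        "inverse (real (Suc n)) \<le> inverse (real (Suc N))"
        using that by (auto intro!: le_imp_inverse_le)
      then have "(dist (f m) (f n))\<^sup>2 < e\<^sup>2" using close[of m n] N by linarith
      then show ?thesis using e by (simp add: power_less_imp_less_base)
    qed
    then show "\<exists>N. \<forall>m\<ge>N. \<forall>n\<ge>N. dist (f m) (f n) < e" by blast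
  qed
  then obtain y where y: "f \<longlonglongrightarrow> y" using Cauchy_convergent convergent_def by blast
  have yS: "y \<in> S" using closed_sequentially S(2) fS y by blast
  have "(\<lambda>n. (norm (x - f n))\<^sup>2) \<longlonglongrightarrow> (norm (x - y))\<^sup>2"
    by (intro tendsto_intros y)
  moreover have "(\<lambda>n. d + inverse (real (Suc n))) \<longlonglongrightarrow> d + 0"
    by (intro tendsto_add tendsto_const LIMSEQ_inverse_real_of_nat)
  ultimately have "(norm (x - y))\<^sup>2 \<le> d + 0"
    by (rule LIMSEQ_le) (use f less_imp_le in blast)
  then have "norm (x - y) \<le> norm (x - z)" if "z \<in> S" for z
    using dle[OF that] by (simp add: power2_le_imp_le)
  with yS that show ?thesis by blast
qed

lemma projection_exists:
  fixes S :: "'a::chilbert_space set"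
  assumes S: "csubspace S" "closed S"
  obtains y where "y \<in> S" "x - y \<in> perp S"
proof -
  have sub: "subspace S" using S(1) by (rule csubspace_imp_subspace)
  obtain y where y: "y \<in> S" "\<And>z. z \<in> S \<Longrightarrow> norm (x - y) \<le> norm (x - z)"
    using closed_subspace_closest_point[OF sub S(2)] by blast
  have "inner (x - y) z = 0" if "z \<in> S" for z
  proof (rule closest_point_imp_orthogonal)
    fix t :: real
    have "y + t *\<^sub>R z \<in> S" using sub y(1) that by (simp add: subspace_add subspace_scale)
    then show "norm (x - y) \<le> norm (x - y - t *\<^sub>R z)" using y(2) by (metis diff_diff_add)
  qed
  \<comment> \<open>Minimality yields real orthogonality only; using it for
    \<open>\<i> *\<^sub>C z\<close> as well makes the imaginary part vanish.\<close>
  moreover have "\<i> *\<^sub>C z \<in> S" if "z \<in> S" for z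
    using S(1) that complex_vector.subspace_scale by blast
  ultimately have "x - y \<in> perp S" by (simp add: perp_def cinner_eq_0_iff)
  with y(1) that show ?thesis by blast
qed

text \<open>Two candidates differ by a vector lying in both \<open>S\<close> and
  \<open>perp S\<close>. The definite description can thereby be evaluated from any admissible
  \<open>y\<close>.\<close>

lemma proj_eqI:
  assumes "csubspace S" "y \<in> S" "x - y \<in> perp S"
  shows "proj S x = y"
  unfolding proj_def
proof (rule the_equality)
  fix z assume z: "z \<in> S \<and> x - z \<in> perp S"
  have "z - y \<in> S" using z assms complex_vector.subspace_diff by blast
  moreover have "(x - y) - (x - z) \<in> perp S"
    using z assms csubspace_perp complex_vector.subspace_diff by blast
  ultimately show "z = y" using perp_Int_eq_0[of "z - y" S] by simp
qed (use assms in auto)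

section \<open>Linearity and boundedness of the projection, double complements\<close>

context
  fixes S :: "'a::chilbert_space set"
  assumes S: "csubspace S" "closed S"
begin

lemma proj_in: "proj S x \<in> S"
  and proj_perp: "x - proj S x \<in> perp S"
  by (metis S projection_exists proj_eqI)+

lemma proj_eq_0_iff: "proj S x = 0 \<longleftrightarrow> x \<in> perp S"
proof
  show "proj S x = 0 \<Longrightarrow> x \<in> perp S" using proj_perp[of x] by simp
  show "x \<in> perp S \<Longrightarrow> proj S x = 0"
    using S(1) by (intro proj_eqI) (auto simp: complex_vector.subspace_0)
qed

lemma proj_id: "x \<in> S \<Longrightarrow> proj S x = x"
  using S(1) csubspace_perp[of S] by (intro proj_eqI) (auto simp: complex_vector.subspace_0)

lemma proj_add: "proj S (x + y) = proj S x + proj S y"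
proof (rule proj_eqI[OF S(1)])
  show "proj S x + proj S y \<in> S" using S(1) proj_in complex_vector.subspace_add by blast
  have "(x - proj S x) + (y - proj S y) \<in> perp S"
    using proj_perp csubspace_perp complex_vector.subspace_add by blast
  then show "x + y - (proj S x + proj S y) \<in> perp S" by (simp add: algebra_simps)
qed

lemma proj_scaleC: "proj S (c *\<^sub>C x) = c *\<^sub>C proj S x"
proof (rule proj_eqI[OF S(1)])
  show "c *\<^sub>C proj S x \<in> S" using S(1) proj_in complex_vector.subspace_scale by blast
  have "c *\<^sub>C (x - proj S x) \<in> perp S"
    using proj_perp csubspace_perp complex_vector.subspace_scale by blast
  then show "c *\<^sub>C x - c *\<^sub>C proj S x \<in> perp S"
    by (simp add: complex_vector.scale_right_diff_distrib)
qed

lemma norm_proj_le: "norm (proj S x) \<le> norm x"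
proof -
  have "inner (x - proj S x) (proj S x) = 0"
    using inner_perp proj_in proj_perp by blast
  then have "inner (proj S x) (proj S x) = inner x (proj S x)"
    by (simp add: inner_diff_left)
  then have "norm (proj S x) * norm (proj S x) \<le> norm x * norm (proj S x)"
    by (metis norm_cauchy_schwarz norm_eq_sqrt_inner power2_eq_square power2_norm_eq_inner)
  then show ?thesis
    by (metis mult_right_le_imp_le norm_ge_zero zero_less_norm_iff norm_zero)
qed

lemma proj_bounded_ops: "proj S \<in> bounded_ops UNIV S"
  unfolding bounded_ops_def using proj_in proj_add proj_scaleC norm_proj_le
  by (auto intro!: exI[of _ 1])

text \<open>For \<open>x\<close> in the double complement, \<open>x - proj S x\<close> lies there as
  well as in \<open>perp S\<close>, hence vanishes.\<close>

lemma perp_perp: "perp (perp S) = S"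
proof
  show "perp (perp S) \<subseteq> S"
  proof
    fix x assume x: "x \<in> perp (perp S)"
    have "proj S x \<in> perp (perp S)" using subset_perp_perp proj_in by blast
    then have "x - proj S x \<in> perp (perp S)"
      using x csubspace_perp complex_vector.subspace_diff by blast
    then have "x - proj S x = 0" using proj_perp perp_Int_eq_0 by blast
    then show "x \<in> S" using proj_in[of x] by simp
  qed
qed (rule subset_perp_perp)

end

section \<open>Bounded operators between subspaces\<close>

text \<open>The target may become any set containing the image; in this way operators on the whole
  space turn into block entries.\<close>

lemma bounded_ops_mono:
  "f \<in> bounded_ops S' T' \<Longrightarrow> S \<subseteq> S' \<Longrightarrow> f ` S \<subseteq> T \<Longrightarrow> f \<in> bounded_ops S T"
  by (auto simp: bounded_ops_def subset_iff) blast+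

lemma bounded_ops_comp:
  assumes "f \<in> bounded_ops S T" "g \<in> bounded_ops T U"
  shows "g \<circ> f \<in> bounded_ops S U"
proof -
  obtain K L where K: "\<forall>x\<in>S. norm (f x) \<le> K * norm x" and L: "\<forall>x\<in>T. norm (g x) \<le> L * norm x"
    using assms by (auto simp: bounded_ops_def)
  have fT: "f x \<in> T" if "x \<in> S" for x using assms(1) that by (auto simp: bounded_ops_def)
  \<comment> \<open>\<open>L\<close> may be negative, so it is replaced by
    \<open>\<bar>L\<bar>\<close> before the estimate for \<open>f x\<close> is multiplied by
    it.\<close>
  have "norm (g (f x)) \<le> (\<bar>L\<bar> * K) * norm x" if "x \<in> S" for x
  proof -
    have "norm (g (f x)) \<le> L * norm (f x)" using L fT[OF that] by blast
    also have "\<dots> \<le> \<bar>L\<bar> * norm (f x)" by (simp add: mult_right_mono)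
    also have "\<dots> \<le> \<bar>L\<bar> * (K * norm x)" using K that by (simp add: mult_left_mono)
    finally show ?thesis by (simp add: mult.assoc)
  qed
  then show ?thesis
    using assms fT by (auto simp: bounded_ops_def image_subset_iff)
qed

text \<open>Additivity and homogeneity of \<open>g\<close> also involve its values at
  \<open>x + y\<close> and \<open>c *\<^sub>C x\<close>; these points stay in \<open>S\<close>
  because it is a subspace.\<close>

lemma bounded_ops_cong:
  assumes "csubspace S" "f \<in> bounded_ops S T" "\<And>x. x \<in> S \<Longrightarrow> g x = f x"
  shows "g \<in> bounded_ops S T"
proof -
  have "x + y \<in> S" "c *\<^sub>C x \<in> S" if "x \<in> S" "y \<in> S" for x y c
    using that assms(1) complex_vector.subspace_add complex_vector.subspace_scale by blast+
  then show ?thesis using assms(2,3) by (auto simp: bounded_ops_def)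
qed

lemma zero_bounded_ops: "csubspace T \<Longrightarrow> (\<lambda>_. 0) \<in> bounded_ops S T"
  by (auto simp: bounded_ops_def complex_vector.subspace_0 intro!: exI[of _ 0])

lemma fst_bounded_ops: "fst \<in> bounded_ops (S \<times> T) S"
  by (auto simp: bounded_ops_def scaleC_prod_def intro!: exI[of _ 1] norm_fst_le)

lemma snd_bounded_ops: "snd \<in> bounded_ops (S \<times> T) T"
  by (auto simp: bounded_ops_def scaleC_prod_def intro!: exI[of _ 1] norm_snd_le)

lemma Pair_bounded_ops:
  assumes "f \<in> bounded_ops S T" "g \<in> bounded_ops S U"
  shows "(\<lambda>x. (f x, g x)) \<in> bounded_ops S (T \<times> U)"
proof -
  obtain K L where K: "\<forall>x\<in>S. norm (f x) \<le> K * norm x" and L: "\<forall>x\<in>S. norm (g x) \<le> L * norm x"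
    using assms by (auto simp: bounded_ops_def)
  have "norm (f x, g x) \<le> (K + L) * norm x" if "x \<in> S" for x
  proof -
    have "norm (f x, g x) \<le> norm (f x) + norm (g x)" by (simp add: norm_Pair_le)
    also have "\<dots> \<le> (K + L) * norm x" using K L that by (simp add: distrib_right add_mono)
    finally show ?thesis .
  qed
  then show ?thesis using assms by (auto simp: bounded_ops_def scaleC_prod_def image_subset_iff)
qed

lemma row_op_bounded_ops:
  assumes T: "csubspace T" and f: "f \<in> bounded_ops S T" and g: "g \<in> bounded_ops U T"
  shows "row_op f g \<in> bounded_ops (S \<times> U) T"
proof -
  obtain K L where K: "\<forall>x\<in>S. norm (f x) \<le> K * norm x" and L: "\<forall>x\<in>U. norm (g x) \<le> L * norm x"
    using f g by (auto simp: bounded_ops_def)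
  have "norm (f x + g y) \<le> (\<bar>K\<bar> + \<bar>L\<bar>) * norm (x, y)" if "x \<in> S" "y \<in> U" for x y
  proof -
    have "norm (f x) \<le> K * norm x" "norm (g y) \<le> L * norm y" using K L that by blast+
    moreover have "K * norm x \<le> \<bar>K\<bar> * norm (x, y)" "L * norm y \<le> \<bar>L\<bar> * norm (x, y)"
      using norm_fst_le[of x y] norm_snd_le[where x = x and y = y] by (auto intro!: mult_mono)
    ultimately show ?thesis
      using norm_triangle_ineq[of "f x" "g y"] by (simp add: distrib_right)
  qed
  then have "\<exists>K. \<forall>x\<in>S. \<forall>y\<in>U. norm (f x + g y) \<le> K * norm (x, y)" by blast
  moreover have "f x + g y \<in> T" if "x \<in> S" "y \<in> U" for x y
    using that f g by (intro complex_vector.subspace_add[OF T]) (auto simp: bounded_ops_def)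
  ultimately show ?thesis
    using f g
    by (auto simp: bounded_ops_def row_op_def scaleC_prod_def scaleC_add_right algebra_simps)
qed

section \<open>Operators on the whole space, their ranges and kernels\<close>

context
  fixes f :: "'a::complex_inner \<Rightarrow> 'b::complex_inner" and T :: "'b set"
  assumes f: "f \<in> bounded_ops UNIV T"
begin

lemma bounded_ops_add: "f (x + y) = f x + f y"
  and bounded_ops_scaleC: "f (c *\<^sub>C x) = c *\<^sub>C f x"
  using f by (auto simp: bounded_ops_def)

lemma bounded_ops_bounded_linear: "bounded_linear f"
proof -
  obtain K where "\<And>x. norm (f x) \<le> K * norm x" using f by (auto simp: bounded_ops_def)
  then show ?thesis
    by (intro bounded_linear_intro[of f K])
      (simp_all add: bounded_ops_add bounded_ops_scaleC scaleR_scaleC mult.commute)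
qed

lemma bounded_ops_0: "f 0 = 0"
  and bounded_ops_diff: "f (x - y) = f x - f y"
  using bounded_ops_bounded_linear
  by (auto simp: linear_simps bounded_linear.linear linear_0)

lemma csubspace_range: "csubspace (range f)"
proof -
  have "f x + f y \<in> range f" "c *\<^sub>C f x \<in> range f" for x y c
    by (metis bounded_ops_add rangeI, metis bounded_ops_scaleC rangeI)
  moreover have "0 \<in> range f" by (metis bounded_ops_0 rangeI)
  ultimately show ?thesis by (auto simp: complex_vector.subspace_def)
qed

lemma csubspace_kernel: "csubspace (kernel f)"
  by (auto simp: complex_vector.subspace_def kernel_def bounded_ops_0 bounded_ops_add
      bounded_ops_scaleC)

lemma closed_kernel: "closed (kernel f)"
  unfolding kernel_def
  by (intro closed_Collect_eq continuous_intros linear_continuous_on bounded_ops_bounded_linear)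

end

section \<open>Closures and complements of subspaces\<close>

lemma csubspace_closure:
  assumes "csubspace S"
  shows "csubspace (closure (S :: 'a::complex_inner set))"
proof -
  have "c *\<^sub>C x \<in> closure S" if x: "x \<in> closure S" for c x
  proof -
    have "scaleC c ` closure S \<subseteq> closure (scaleC c ` S)"
      by (rule closure_bounded_linear_image_subset[OF bounded_linear_scaleC])
    also have "\<dots> \<subseteq> closure S"
      using assms complex_vector.subspace_scale by (intro closure_mono) blast
    finally show ?thesis using x by blast
  qed
  moreover have "x + y \<in> closure S" if xy: "x \<in> closure S" "y \<in> closure S" for x y
  proof -
    obtain f g where "\<And>n. f n \<in> S" "f \<longlonglongrightarrow> x" "\<And>n. g n \<in> S" "g \<longlonglongrightarrow> y"
      using xy unfolding closure_sequential by metis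
    then have "\<And>n. f n + g n \<in> S" "(\<lambda>n. f n + g n) \<longlonglongrightarrow> x + y"
      using assms complex_vector.subspace_add by (blast, intro tendsto_add)
    then show ?thesis
      unfolding closure_sequential by (intro exI[of _ "\<lambda>n. f n + g n"]) simp
  qed
  moreover have "0 \<in> closure S"
    using assms complex_vector.subspace_0 closure_subset by blast
  ultimately show ?thesis by (simp add: complex_vector.subspace_def)
qed

text \<open>\<open>perp (perp S)\<close> is closed and so contains \<open>closure S\<close>. Passing
  to complements, \<open>perp S\<close> lies in the triple complement, and this in
  \<open>perp (closure S)\<close>.\<close>

lemma perp_closure: "perp (closure S) = perp S"
proof
  show "perp (closure S) \<subseteq> perp S" by (intro perp_antimono closure_subset)
  have "closure S \<subseteq> perp (perp S)"
    by (intro closure_minimal subset_perp_perp closed_perp)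
  then show "perp S \<subseteq> perp (closure S)"
    using subset_perp_perp[of "perp S"] perp_antimono by blast
qed

lemma closure_csubspace_eq:
  "csubspace S \<Longrightarrow> closure S = perp (perp (S :: 'a::chilbert_space set))"
  using perp_perp[of "closure S"] by (simp add: csubspace_closure perp_closure)

lemma proj_comp_bounded_ops:
  assumes f: "f \<in> bounded_ops UNIV UNIV"
    and T: "csubspace T" "closed (T :: 'a::chilbert_space set)"
  shows "proj T \<circ> f \<in> bounded_ops S T"
  using bounded_ops_comp[OF f proj_bounded_ops[OF T]]
  by (rule bounded_ops_mono) (auto simp: proj_in[OF T])

text \<open>\<open>inv_into S f\<close> is identified with \<open>g\<close> on \<open>T\<close>, and
  \<open>bounded_ops_cong\<close> transfers boundedness to it.\<close>

lemma isomorphism_onI: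
  assumes T: "csubspace T"
    and f: "f \<in> bounded_ops S T" and g: "g \<in> bounded_ops T S"
    and gf: "\<And>x. x \<in> S \<Longrightarrow> g (f x) = x" and fg: "\<And>y. y \<in> T \<Longrightarrow> f (g y) = y"
  shows "isomorphism_on S T f"
proof -
  have maps: "f ` S \<subseteq> T" "g ` T \<subseteq> S" using f g by (auto simp: bounded_ops_def)
  then have bij: "bij_betw f S T" by (intro bij_betw_byWitness[of S g]) (auto simp: gf fg)
  have "inv_into S f y = g y" if "y \<in> T" for y
    using bij maps that fg by (metis bij_betw_imp_inj_on image_subset_iff inv_into_f_f)
  then show ?thesis
    unfolding isomorphism_on_def using f bij bounded_ops_cong[OF T g] by blast
qed

text \<open>Columns with a single nonzero component isolate the entries; conversely, linearity of
  the projected operator adds them up. The quantification over all columns thus reduces to one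
  condition per block.\<close>

lemma represents_iff:
  assumes Ss: "\<forall>S\<in>set Ss. csubspace S" and Ws: "\<forall>W\<in>set Ws. csubspace W \<and> closed W"
    and T: "T \<in> bounded_ops UNIV UNIV"
  shows "represents T Ss Ws (M :: ('a::complex_inner \<Rightarrow> 'b::chilbert_space) list list) \<longleftrightarrow>
    length M = length Ws \<and> (\<forall>i<length Ws. length (M ! i) = length Ss) \<and>
    (\<forall>i<length Ws. \<forall>j<length Ss. M ! i ! j \<in> bounded_ops (Ss ! j) (Ws ! i) \<and>
      (\<forall>v\<in>Ss ! j. (M ! i ! j) v = proj (Ws ! i) (T v)))"
    (is "?L \<longleftrightarrow> ?R")
proof
  assume L: ?L
  have "(M ! i ! j) v = proj (Ws ! i) (T v)"
    if i: "i < length Ws" and j: "j < length Ss" and v: "v \<in> Ss ! j" for i j v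
  proof -
    define x where "x = (\<lambda>k. if k = j then v else 0)"
    have x0: "0 \<in> Ss ! k" if "k < length Ss" for k
      using Ss that complex_vector.subspace_0 nth_mem by blast
    have M0: "(M ! i ! k) 0 = 0" if k: "k < length Ss" for k
    proof -
      \<comment> \<open>Homogeneity is known on \<open>Ss ! k\<close> only; with scalar 0 it gives
        the value at 0.\<close>
      have "(M ! i ! k) (0 *\<^sub>C 0) = 0 *\<^sub>C (M ! i ! k) 0"
        using L i k x0[OF k] unfolding represents_def bounded_ops_def by blast
      then show ?thesis by simp
    qed
    have "\<forall>k<length Ss. x k \<in> Ss ! k" using v x0 by (auto simp: x_def)
    then have "proj (Ws ! i) (T (\<Sum>k<length Ss. x k)) = (\<Sum>k<length Ss. (M ! i ! k) (x k))"
      using L i unfolding represents_def by blast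
    moreover have "(\<Sum>k<length Ss. x k) = v"
      using j by (simp add: x_def)
    moreover have "(\<Sum>k<length Ss. (M ! i ! k) (x k))
        = (\<Sum>k<length Ss. if k = j then (M ! i ! j) v else 0)"
      using M0 by (intro sum.cong) (auto simp: x_def)
    ultimately show ?thesis using j by simp
  qed
  with L show ?R unfolding represents_def by simp
next
  assume R: ?R
  have "proj (Ws ! i) (T (\<Sum>j<length Ss. x j)) = (\<Sum>j<length Ss. (M ! i ! j) (x j))"
    if x: "\<forall>j<length Ss. x j \<in> Ss ! j" and i: "i < length Ws" for x i
  proof -
    have W: "csubspace (Ws ! i)" "closed (Ws ! i)" using Ws i by auto
    have "linear (proj (Ws ! i) \<circ> T)"
      using bounded_ops_comp[OF T proj_bounded_ops[OF W]]
      by (intro bounded_linear.linear bounded_ops_bounded_linear)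
    then have "(proj (Ws ! i) \<circ> T) (\<Sum>j<length Ss. x j) = (\<Sum>j<length Ss. (proj (Ws ! i) \<circ> T) (x j))"
      by (rule linear_sum)
    also have "\<dots> = (\<Sum>j<length Ss. (M ! i ! j) (x j))"
      using R x i by (intro sum.cong) auto
    finally show ?thesis by simp
  qed
  with R show ?L unfolding represents_def by simp
qed

section \<open>Orthogonal sums\<close>

lemma csubspace_ominus: "csubspace S \<Longrightarrow> csubspace (S \<ominus> T)"
  unfolding ominus_def by (intro complex_vector.subspace_inter csubspace_perp)

lemma closed_ominus: "closed S \<Longrightarrow> closed (S \<ominus> T)"
  unfolding ominus_def by (intro closed_Int closed_perp)

lemma csubspace_Times: "csubspace S \<Longrightarrow> csubspace T \<Longrightarrow> csubspace (S \<times> T)"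
  by (auto simp: complex_vector.subspace_def scaleC_prod_def zero_prod_def)

lemma csubspace_0: "csubspace {0}"
  by (auto simp: complex_vector.subspace_def)

text \<open>The summands of \<open>x\<close> are \<open>proj N x\<close>,
  \<open>proj K x - proj N x\<close> and \<open>x - proj K x\<close>. Here \<open>N\<close> stands
  for the kernel of an operator and \<open>K\<close> for the kernel of that operator followed by a
  projection.\<close>

lemma orthogonal_sum_nested:
  fixes N K :: "'a::chilbert_space set"
  assumes N: "csubspace N" "closed N" and K: "csubspace K" "closed K" and NK: "N \<subseteq> K"
  shows "orthogonal_sum UNIV [N, perp N \<ominus> perp K, perp K]"
proof -
  have "x \<in> N + ((perp N \<ominus> perp K) + (perp K + {0}))" for x
  proof -
    \<comment> \<open>Both \<open>x - proj N x\<close> and \<open>x - proj K x\<close> are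
      orthogonal to \<open>N\<close>, the second because \<open>N\<close> lies in
      \<open>K\<close>.\<close>
    have "proj K x - proj N x = (x - proj N x) - (x - proj K x)" by simp
    also have "\<dots> \<in> perp N"
      using proj_perp[OF N] proj_perp[OF K] perp_antimono[OF NK] csubspace_perp
        complex_vector.subspace_diff by blast
    finally have "proj K x - proj N x \<in> perp N" .
    moreover have "proj K x - proj N x \<in> K"
      using proj_in[OF K] proj_in[OF N] NK by (intro complex_vector.subspace_diff[OF K(1)]) blast+
    ultimately have "proj K x - proj N x \<in> perp N \<ominus> perp K"
      by (simp add: ominus_def perp_perp[OF K])
    then have "proj N x + ((proj K x - proj N x) + ((x - proj K x) + 0))
        \<in> N + ((perp N \<ominus> perp K) + (perp K + {0}))"
      using proj_in[OF N] proj_perp[OF K] by (intro set_plus_intro) auto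
    then show ?thesis by simp
  qed
  moreover have "cinner x y = 0" if "x \<in> N" "y \<in> perp N \<ominus> perp K \<or> y \<in> perp K" for x y
    using that NK by (auto simp: ominus_def perp_def cinner_eq_0_commute)
  moreover have "cinner x y = 0" if "x \<in> perp N \<ominus> perp K" "y \<in> perp K" for x y
    using that by (auto simp: ominus_def perp_def)
  ultimately show ?thesis
    unfolding orthogonal_sum_def
    by (auto simp: N csubspace_perp closed_perp csubspace_ominus closed_ominus)
qed

lemma orthogonal_sum_prod:
  assumes S: "orthogonal_sum UNIV [S1, S2, S3]" and T: "orthogonal_sum UNIV [T1, T2, T3]"
  shows "orthogonal_sum UNIV
    [S1 \<times> {0}, S2 \<times> {0}, S3 \<times> {0}, {0} \<times> T3, {0} \<times> T2, {0} \<times> T1]"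
proof -
  have "(x, y) \<in> S1 \<times> {0} + (S2 \<times> {0} + (S3 \<times> {0} + ({0} \<times> T3 + ({0} \<times> T2 + ({0} \<times> T1 + {0})))))"
    for x y
  proof -
    have "x \<in> S1 + (S2 + (S3 + {0}))" "y \<in> T1 + (T2 + (T3 + {0}))"
      using S T by (auto simp: orthogonal_sum_def)
    then obtain x1 x2 x3 y1 y2 y3 where x: "x = x1 + (x2 + x3)" and y: "y = y1 + (y2 + y3)"
      and mem: "x1 \<in> S1" "x2 \<in> S2" "x3 \<in> S3" "y1 \<in> T1" "y2 \<in> T2" "y3 \<in> T3"
      by (auto elim!: set_plus_elim)
    have "(x1, 0) + ((x2, 0) + ((x3, 0) + ((0, y3) + ((0, y2) + ((0, y1) + 0)))))
      \<in> S1 \<times> {0} + (S2 \<times> {0} + (S3 \<times> {0} + ({0} \<times> T3 + ({0} \<times> T2 + ({0} \<times> T1 + {0})))))"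
      using mem by (intro set_plus_intro) auto
    then show ?thesis by (simp add: x y add_ac)
  qed
  then have "UNIV = S1 \<times> {0} + (S2 \<times> {0} + (S3 \<times> {0} + ({0} \<times> T3 + ({0} \<times> T2 + ({0} \<times> T1 + {0})))))"
    by (intro equalityI subsetI) (simp_all add: split_paired_all del: add_0_right)
  moreover have "\<forall>x\<in>S1. \<forall>y\<in>S2. cinner x y = 0" "\<forall>x\<in>S1. \<forall>y\<in>S3. cinner x y = 0"
    "\<forall>x\<in>S2. \<forall>y\<in>S3. cinner x y = 0"
    using S by (simp_all add: orthogonal_sum_def)
  moreover have "\<forall>y\<in>T1. \<forall>x\<in>T2. cinner y x = 0" "\<forall>y\<in>T1. \<forall>x\<in>T3. cinner y x = 0"
    "\<forall>y\<in>T2. \<forall>x\<in>T3. cinner y x = 0"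
    using T by (simp_all add: orthogonal_sum_def)
  \<comment> \<open>The second family is listed in reverse order, so its orthogonality relations
    have to be reflected.\<close>
  then have "\<forall>x\<in>T2. \<forall>y\<in>T1. cinner x y = 0" "\<forall>x\<in>T3. \<forall>y\<in>T1. cinner x y = 0"
    "\<forall>x\<in>T3. \<forall>y\<in>T2. cinner x y = 0"
    using cinner_eq_0_commute by blast+
  moreover have "csubspace S1" "csubspace S2" "csubspace S3" "closed S1" "closed S2" "closed S3"
    "csubspace T1" "csubspace T2" "csubspace T3" "closed T1" "closed T2" "closed T3"
    using S T by (simp_all add: orthogonal_sum_def)
  ultimately show ?thesis
    unfolding orthogonal_sum_def
    by (simp add: closed_Times csubspace_Times csubspace_0 cinner_prod_def)
qed

section \<open>Right invertible row operators\<close>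

text \<open>The pairs \<open>(A, C)\<close> and \<open>(B, D)\<close> are interchangeable, so each
  fact about \<open>A\<close> also serves for \<open>B\<close>. Separate types for the two domains
  and the codomain make the exchange possible.\<close>

locale right_inverse_pair =
  fixes A :: "'x::chilbert_space \<Rightarrow> 'z::chilbert_space"
    and B :: "'y::chilbert_space \<Rightarrow> 'z"
    and C :: "'z \<Rightarrow> 'x" and D :: "'z \<Rightarrow> 'y"
  assumes A: "A \<in> bounded_ops UNIV UNIV" and B: "B \<in> bounded_ops UNIV UNIV"
    and C: "C \<in> bounded_ops UNIV UNIV" and D: "D \<in> bounded_ops UNIV UNIV"
    and right_inverse: "A (C z) + B (D z) = z"
begin

lemma swap: "right_inverse_pair B A D C"
  using A B C D right_inverse by unfold_locales (auto simp: add.commute)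

text \<open>The spaces \<open>X2\<close> and \<open>perp K\<close> yield the second and third
  column, and \<open>M\<close> is the third row space. Under \<open>swap\<close> they become the
  spaces built from \<open>B\<close>, with the intersection in \<open>M\<close> reversed.\<close>

abbreviation "K \<equiv> kernel (proj (perp (range B)) \<circ> A)"
abbreviation "M \<equiv> closure (range A) \<inter> closure (range B)"
abbreviation "X2 \<equiv> perp (kernel A) \<ominus> perp K"

lemmas csubspace_rangeA = csubspace_range[OF A]
lemmas csubspace_rangeB = csubspace_range[OF B]

lemma csubspace_M: "csubspace M"
  by (intro complex_vector.subspace_inter csubspace_closure csubspace_rangeA csubspace_rangeB)

lemma projA: "proj (perp (range B)) \<circ> A \<in> bounded_ops UNIV (perp (range B))"
  by (rule proj_comp_bounded_ops[OF A csubspace_perp closed_perp])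

lemmas csubspace_K = csubspace_kernel[OF projA]
lemmas closed_K = closed_kernel[OF projA]
lemmas csubspace_kernelA = csubspace_kernel[OF A]
lemmas closed_kernelA = closed_kernel[OF A]

lemma proj_perp_range_eq_0_iff: "proj (perp (range B)) z = 0 \<longleftrightarrow> z \<in> closure (range B)"
  by (simp only: proj_eq_0_iff[OF csubspace_perp closed_perp] closure_csubspace_eq[OF csubspace_rangeB])

lemma proj_perp_range: "proj (perp (range B)) (B y) = 0"
  unfolding proj_perp_range_eq_0_iff by (rule subsetD[OF closure_subset rangeI])

lemma K_iff: "x \<in> K \<longleftrightarrow> A x \<in> closure (range B)"
  by (simp add: kernel_def proj_perp_range_eq_0_iff)

lemma kernel_subset_K: "kernel A \<subseteq> K"
  using complex_vector.subspace_0[OF csubspace_closure[OF csubspace_rangeB]]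
  by (auto simp: K_iff) (simp add: kernel_def)

lemma A_K: "x \<in> K \<Longrightarrow> A x \<in> M"
  unfolding K_iff by (blast intro: subsetD[OF closure_subset rangeI])

text \<open>The projection annihilates \<open>B (D z)\<close>. This identity supplies both the
  inverse on \<open>perp K\<close> and the correction term in the density proof.\<close>

lemma proj_A_C: "proj (perp (range B)) (A (C z)) = proj (perp (range B)) z"
proof -
  have "proj (perp (range B)) z = proj (perp (range B)) (A (C z) + B (D z))"
    by (simp add: right_inverse)
  also have "\<dots> = proj (perp (range B)) (A (C z))"
    by (simp only: proj_add[OF csubspace_perp closed_perp] proj_perp_range add_0_right)
  finally show ?thesis ..
qed

lemma C_M: "m \<in> M \<Longrightarrow> C m \<in> K"
  unfolding K_iff proj_perp_range_eq_0_iff[symmetric] proj_A_C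
  by (simp add: proj_perp_range_eq_0_iff)

section \<open>The column spaces and the action of \<open>A\<close> on them\<close>

lemma domain_decomposition: "orthogonal_sum UNIV [kernel A, X2, perp K]"
  by (intro orthogonal_sum_nested csubspace_kernelA closed_kernelA csubspace_K closed_K
      kernel_subset_K)

text \<open>\<open>K\<close> is a closed subspace, so the double complement hidden in
  \<open>X2\<close> collapses.\<close>

lemma X2_eq: "X2 = perp (kernel A) \<inter> K"
  by (simp add: ominus_def perp_perp[OF csubspace_K closed_K])

lemma csubspace_X2: "csubspace X2"
  by (intro csubspace_ominus csubspace_perp)

lemma closed_X2: "closed X2"
  by (intro closed_ominus closed_perp)

text \<open>For \<open>x\<close> in \<open>K\<close>, projecting onto \<open>X2\<close> removes just
  the component in the kernel of \<open>A\<close>.\<close>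

lemma A_proj_X2:
  assumes "x \<in> K"
  shows "A (proj X2 x) = A x"
proof -
  let ?n = "proj (kernel A) x"
  have n: "?n \<in> kernel A" and xn: "x - ?n \<in> perp (kernel A)"
    using proj_in proj_perp csubspace_kernelA closed_kernelA by blast+
  have "x - ?n \<in> K"
    using assms n kernel_subset_K csubspace_K complex_vector.subspace_diff by blast
  \<comment> \<open>This difference is the kernel vector \<open>?n\<close>, and \<open>X2\<close>
    lies in the complement of the kernel.\<close>
  moreover have "x - (x - ?n) \<in> perp X2"
    using n subset_perp_perp[of "kernel A"] perp_antimono[of X2 "perp (kernel A)"]
    by (auto simp: X2_eq)
  ultimately have "proj X2 x = x - ?n"
    using xn by (intro proj_eqI csubspace_X2) (auto simp: X2_eq)
  then show ?thesis
    using n by (simp add: bounded_ops_diff[OF A]) (simp add: kernel_def)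
qed

lemma isomorphism_on_perp_K:
  assumes f: "f \<in> bounded_ops (perp K) (perp (range B))"
    and eq: "\<And>x. x \<in> perp K \<Longrightarrow> f x = proj (perp (range B)) (A x)"
  shows "isomorphism_on (perp K) (perp (range B)) f"
proof (rule isomorphism_onI[OF csubspace_perp f])
  have pk: "csubspace (perp K)" "closed (perp K)" by (rule csubspace_perp closed_perp)+
  have in_K: "x - proj (perp K) x \<in> K" for x
    using proj_perp[OF pk] perp_perp[OF csubspace_K closed_K] by blast
  \<comment> \<open>The arguments \<open>x\<close> and \<open>proj (perp K) x\<close> differ by an
    element of \<open>K\<close>, which \<open>A\<close> followed by the projection
    annihilates.\<close>
  have fproj: "f (proj (perp K) x) = proj (perp (range B)) (A x)" for x
  proof -
    have "(proj (perp (range B)) \<circ> A) (x - proj (perp K) x) = 0"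
      using in_K by (simp add: kernel_def)
    then show ?thesis
      unfolding bounded_ops_diff[OF projA] using eq proj_in[OF pk] by simp
  qed
  show "proj (perp K) \<circ> C \<in> bounded_ops (perp (range B)) (perp K)"
    by (rule proj_comp_bounded_ops[OF C pk])
  show "f ((proj (perp K) \<circ> C) u) = u" if "u \<in> perp (range B)" for u
    using proj_id[OF csubspace_perp closed_perp that] by (simp add: fproj proj_A_C)
  show "(proj (perp K) \<circ> C) (f x) = x" if x: "x \<in> perp K" for x
  proof -
    \<comment> \<open>Injectivity on \<open>perp K\<close>: \<open>?z\<close> is sent to 0 and so
      lies in \<open>K\<close>, but as a difference of two elements of \<open>perp K\<close> it is
      also orthogonal to \<open>K\<close>.\<close>
    let ?z = "proj (perp K) (C (f x)) - x"
    have fx: "f x = proj (perp (range B)) (A x)" using eq x by blast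
    have "proj (perp (range B)) (A (proj (perp K) (C (f x)))) = f (proj (perp K) (C (f x)))"
      using eq proj_in[OF pk] by simp
    also have "\<dots> = proj (perp (range B)) (f x)" by (simp add: fproj proj_A_C)
    also have "\<dots> = f x" unfolding fx
      by (intro proj_id proj_in csubspace_perp closed_perp)
    finally have "(proj (perp (range B)) \<circ> A) ?z = 0"
      unfolding bounded_ops_diff[OF projA] using fx by simp
    then have "?z \<in> K" by (simp add: kernel_def)
    moreover have "?z \<in> perp K"
      using proj_in[OF pk] x pk(1) complex_vector.subspace_diff by blast
    ultimately have "?z = 0" by (rule perp_Int_eq_0)
    then show ?thesis by simp
  qed
qed

lemma closure_image_X2: "closure (A ` X2) = M"
proof
  show "closure (A ` X2) \<subseteq> M"
    using A_K by (intro closure_minimal closed_Int closed_closure) (auto simp: X2_eq)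
  show "M \<subseteq> closure (A ` X2)"
  proof
    fix m assume m: "m \<in> M"
    then have "m \<in> closure (range A)" by blast
    then obtain a where a: "a \<longlonglongrightarrow> m" "\<And>n. a n \<in> range A"
      unfolding closure_sequential by metis
    then have "\<forall>n. \<exists>x. a n = A x" by blast
    then obtain x where x: "\<And>n. a n = A (x n)" by metis
    let ?p = "\<lambda>z. proj (perp (range B)) z"
    have p: "?p \<in> bounded_ops UNIV (perp (range B))"
      by (intro proj_bounded_ops csubspace_perp closed_perp)
    \<comment> \<open>The preimages \<open>x n\<close> need not lie in \<open>K\<close>. The
      correction removes the component of \<open>A (x n)\<close> in \<open>perp (range B)\<close>,
      by \<open>proj_A_C\<close> and idempotence of the projection.\<close>
    define k where "k n = x n - C (?p (A (x n)))" for n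
    have k: "k n \<in> K" for n
    proof -
      have "?p (A (k n)) = ?p (A (x n)) - ?p (A (C (?p (A (x n)))))"
        by (simp add: k_def bounded_ops_diff[OF A] bounded_ops_diff[OF p])
      also have "\<dots> = 0"
        by (simp add: proj_A_C proj_id[OF csubspace_perp closed_perp]
            proj_in[OF csubspace_perp closed_perp])
      finally show ?thesis by (simp add: kernel_def)
    qed
    have "isCont (\<lambda>z. A (C (?p z))) m"
      using bounded_linear_compose[OF bounded_ops_bounded_linear[OF A]
          bounded_linear_compose[OF bounded_ops_bounded_linear[OF C] bounded_ops_bounded_linear[OF p]]]
      by (rule linear_continuous_at)
    then have "(\<lambda>n. A (C (?p (a n)))) \<longlonglongrightarrow> A (C (?p m))"
      using a(1) by (rule isCont_tendsto_compose)
    then have "(\<lambda>n. a n - A (C (?p (a n)))) \<longlonglongrightarrow> m - A (C (?p m))"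
      by (intro tendsto_diff a)
    \<comment> \<open>Hence the corrections tend to 0, and the corrected sequence still tends to
      \<open>m\<close>.\<close>
    moreover have "?p m = 0" using m by (simp add: proj_perp_range_eq_0_iff)
    \<comment> \<open>\<open>A_proj_X2\<close> moves the points from \<open>K\<close> into
      \<open>X2\<close> without changing their images.\<close>
    moreover have "a n - A (C (?p (a n))) = A (proj X2 (k n))" for n
      using A_proj_X2[OF k] by (simp add: k_def x bounded_ops_diff[OF A])
    ultimately have "(\<lambda>n. A (proj X2 (k n))) \<longlonglongrightarrow> m"
      by (simp add: bounded_ops_0[OF A] bounded_ops_0[OF C])
    moreover have "A (proj X2 (k n)) \<in> A ` X2" for n
      using proj_in[OF csubspace_X2 closed_X2] by blast
    ultimately show "m \<in> closure (A ` X2)"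
      unfolding closure_sequential by (intro exI[of _ "\<lambda>n. A (proj X2 (k n))"]) simp
  qed
qed

section \<open>Closedness of the sum of the two complements and decomposition of the
  codomain\<close>

lemma perp_summand_bound:
  obtains L where "\<And>u v. u \<in> perp (range B) \<Longrightarrow> v \<in> perp (range A) \<Longrightarrow> norm u \<le> L * norm (u + v)"
proof -
  obtain L where L: "\<And>z. norm ((A \<circ> C) z) \<le> L * norm z"
    using bounded_ops_comp[OF C A] by (auto simp: bounded_ops_def)
  have "norm u \<le> L * norm (u + v)" if u: "u \<in> perp (range B)" and v: "v \<in> perp (range A)" for u v
  proof (cases "u = 0")
    case True
    \<comment> \<open>For \<open>u = 0\<close> the claim says that \<open>L * norm v\<close> is
      nonnegative, which the bound for \<open>A (C v)\<close> provides.\<close>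
    then show ?thesis using order_trans[OF norm_ge_zero L[of v]] by simp
  next
    case False
    \<comment> \<open>\<open>B (D u)\<close> is orthogonal to \<open>u\<close>, and
      \<open>A (C u)\<close> to \<open>v\<close>; both sides equal
      \<open>inner u (A (C u))\<close>.\<close>
    have "inner u (A (C u) + B (D u)) = inner (u + v) (A (C u))"
      using inner_perp[OF u] inner_perp[OF v] by (simp add: inner_add_left inner_add_right)
    then have "norm u * norm u = inner (u + v) (A (C u))"
      by (simp add: right_inverse power2_eq_square[symmetric] power2_norm_eq_inner)
    also have "\<dots> \<le> norm (u + v) * norm (A (C u))" by (rule norm_cauchy_schwarz)
    also have "\<dots> \<le> norm (u + v) * (L * norm u)" using L[of u] by (simp add: mult_left_mono)
    finally have "norm u * norm u \<le> (L * norm (u + v)) * norm u" by (simp add: mult_ac)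
    then show ?thesis using False by simp
  qed
  with that show ?thesis by blast
qed

text \<open>A vector \<open>u\<close> orthogonal to both ranges is orthogonal to
  \<open>A (C u) + B (D u)\<close>, which is \<open>u\<close> itself.\<close>

lemma perp_ranges_Int: "perp (range A) \<inter> perp (range B) = {0}"
proof -
  have "u = 0" if u: "u \<in> perp (range A)" "u \<in> perp (range B)" for u
  proof -
    have "inner u (A (C u) + B (D u)) = 0"
      using u by (simp add: inner_add_right inner_perp)
    then show "u = 0" by (simp add: right_inverse)
  qed
  then show ?thesis using complex_vector.subspace_0[OF csubspace_perp] by blast
qed

text \<open>By \<open>perp_summand_bound\<close>, convergence of the sums makes the summands from
  \<open>perp (range B)\<close> Cauchy; the other summands then converge too, and both limits stay
  in their closed spaces.\<close>

lemma closed_perp_plus_perp: "closed (perp (range A) + perp (range B))"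
  unfolding closed_sequential_limits
proof (intro allI impI, elim conjE)
  fix w z assume w: "\<forall>n. w n \<in> perp (range A) + perp (range B)" and z: "w \<longlonglongrightarrow> z"
  have "\<exists>v u. v \<in> perp (range A) \<and> u \<in> perp (range B) \<and> w n = v + u" for n
    using w by (blast elim: set_plus_elim)
  then obtain v u where vu: "\<And>n. v n \<in> perp (range A)" "\<And>n. u n \<in> perp (range B)"
    and w_eq: "\<And>n. w n = v n + u n" by metis
  obtain L where L: "\<And>u v. u \<in> perp (range B) \<Longrightarrow> v \<in> perp (range A) \<Longrightarrow> norm u \<le> L * norm (u + v)"
    using perp_summand_bound by blast
  have dist_u: "dist (u m) (u n) \<le> \<bar>L\<bar> * dist (w m) (w n)" for m n
  proof -
    have "norm (u m - u n) \<le> L * norm ((u m - u n) + (v m - v n))"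
      using vu by (intro L complex_vector.subspace_diff csubspace_perp)
    also have "(u m - u n) + (v m - v n) = w m - w n" by (simp add: w_eq)
    also have "L * norm (w m - w n) \<le> \<bar>L\<bar> * norm (w m - w n)" by (simp add: mult_right_mono)
    finally show ?thesis by (simp add: dist_norm)
  qed
  have "Cauchy u"
  proof (rule metric_CauchyI)
    fix e :: real assume "0 < e"
    \<comment> \<open>Adding 1 keeps the divisor positive even for \<open>L = 0\<close>.\<close>
    then have "0 < e / (\<bar>L\<bar> + 1)" by simp
    then obtain N where N: "\<And>m n. m \<ge> N \<Longrightarrow> n \<ge> N \<Longrightarrow> dist (w m) (w n) < e / (\<bar>L\<bar> + 1)"
      using LIMSEQ_imp_Cauchy[OF z] unfolding Cauchy_def by metis
    have "dist (u m) (u n) < e" if "m \<ge> N" "n \<ge> N" for m n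
    proof -
      have "dist (u m) (u n) \<le> (\<bar>L\<bar> + 1) * dist (w m) (w n)"
        using dist_u[of m n] by (simp add: distrib_right add_increasing2)
      also have "\<dots> < e" using N[OF that] by (simp add: pos_less_divide_eq mult.commute)
      finally show ?thesis .
    qed
    then show "\<exists>N. \<forall>m\<ge>N. \<forall>n\<ge>N. dist (u m) (u n) < e" by blast
  qed
  then obtain u' where u': "u \<longlonglongrightarrow> u'" using Cauchy_convergent convergent_def by blast
  have "(\<lambda>n. w n - u n) \<longlonglongrightarrow> z - u'" by (intro tendsto_diff z u')
  then have "z - u' \<in> perp (range A)"
    using closed_sequentially[OF closed_perp, of "\<lambda>n. w n - u n" "range A"] vu(1)
    by (simp add: w_eq)
  moreover have "u' \<in> perp (range B)"
    using closed_sequentially[OF closed_perp] vu(2) u' by blast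
  ultimately have "(z - u') + u' \<in> perp (range A) + perp (range B)" by (rule set_plus_intro)
  then show "z \<in> perp (range A) + perp (range B)" by simp
qed

lemma codomain_decomposition:
  defines "V \<equiv> perp (range A) + perp (range B)"
  shows "direct_sum V (perp (range A)) (perp (range B))" and "orthogonal_sum UNIV [V, M]"
proof -
  show "direct_sum V (perp (range A)) (perp (range B))"
    by (simp add: direct_sum_def V_def csubspace_perp perp_ranges_Int)
  have sub: "csubspace V"
  proof -
    have "V = {x + y |x y. x \<in> perp (range A) \<and> y \<in> perp (range B)}"
      by (auto simp: V_def set_plus_def)
    then show ?thesis by (simp add: complex_vector.subspace_sums csubspace_perp)
  qed
  have cl: "closed V" unfolding V_def by (rule closed_perp_plus_perp)
  have zero: "0 \<in> perp (range A)" "0 \<in> perp (range B)"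
    by (rule complex_vector.subspace_0[OF csubspace_perp])+
  have "perp (range A) \<subseteq> V"
    using set_plus_intro[OF _ zero(2)] unfolding V_def by (metis add_0_right subsetI)
  moreover have "perp (range B) \<subseteq> V"
    unfolding V_def by (rule set_zero_plus2[OF zero(1)])
  \<comment> \<open>\<open>V\<close> contains both complements, so \<open>perp V\<close> lies in
    both double complements, which are the closures of the ranges.\<close>
  ultimately have "perp V \<subseteq> M"
    unfolding closure_csubspace_eq[OF csubspace_rangeA] closure_csubspace_eq[OF csubspace_rangeB]
    by (intro Int_greatest perp_antimono)
  \<comment> \<open>Closedness of \<open>V\<close> makes the projection onto it available; the
    remainder falls into \<open>perp V\<close> and so into \<open>M\<close>.\<close>
  then have "proj V x + ((x - proj V x) + 0) \<in> V + (M + {0})" for x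
    using proj_in[OF sub cl] proj_perp[OF sub cl] by (intro set_plus_intro) auto
  then have "UNIV = V + (M + {0})" by (intro equalityI subsetI) simp_all
  moreover have "cinner x y = 0" if "x \<in> V" "y \<in> M" for x y
  proof -
    obtain v u where "v \<in> perp (range A)" "u \<in> perp (range B)" "x = v + u"
      using \<open>x \<in> V\<close> unfolding V_def by (rule set_plus_elim)
    moreover from this have "cinner v y = 0" "cinner u y = 0"
      using \<open>y \<in> M\<close> perp_closure[of "range A"] perp_closure[of "range B"] unfolding perp_def
      by blast+
    ultimately show ?thesis by (simp add: cinner_add_left)
  qed
  ultimately show "orthogonal_sum UNIV [V, M]"
    by (auto simp: orthogonal_sum_def sub cl csubspace_M closed_Int)
qed

end

section \<open>Block representation of a right invertible row operator\<close>

theorem theorem2p7: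
  fixes A :: "'a::chilbert_space \<Rightarrow> 'a" and B :: "'b::chilbert_space \<Rightarrow> 'a"
    and X1 X2 X3 M :: "'a set" and Y1 Y2 Y3 :: "'b set"
    and rep :: "('a \<Rightarrow> 'a) \<Rightarrow> ('a \<Rightarrow> 'a) \<Rightarrow> ('a \<Rightarrow> 'a) \<Rightarrow>
                ('b \<Rightarrow> 'a) \<Rightarrow> ('b \<Rightarrow> 'a) \<Rightarrow> ('b \<Rightarrow> 'a) \<Rightarrow> bool"
  assumes "separable_space (euclidean :: 'a topology)"
    and "separable_space (euclidean :: 'b topology)"
    and "A \<in> bounded_ops UNIV UNIV"
    and "B \<in> bounded_ops UNIV UNIV"
    and "right_invertible_on UNIV UNIV (row_op A B)"
  assumes M_def: "M = closure (range A) \<inter> closure (range B)"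
    and X1_def: "X1 = kernel A"
    and X2_def: "X2 = perp (kernel A) \<ominus> perp (kernel (proj (perp (range B)) \<circ> A))"
    and X3_def: "X3 = perp (kernel (proj (perp (range B)) \<circ> A))"
    and Y1_def: "Y1 = kernel B"
    and Y2_def: "Y2 = perp (kernel B) \<ominus> perp (kernel (proj (perp (range A)) \<circ> B))"
    and Y3_def: "Y3 = perp (kernel (proj (perp (range A)) \<circ> B))"
    and rep_def: "\<And>A0 A2 A3 B0 B2 B3. rep A0 A2 A3 B0 B2 B3 \<longleftrightarrow>
      A0 \<in> bounded_ops X3 M \<and> A2 \<in> bounded_ops X2 M \<and> A3 \<in> bounded_ops X3 (perp (range B)) \<and>
      B0 \<in> bounded_ops Y3 M \<and> B2 \<in> bounded_ops Y2 M \<and> B3 \<in> bounded_ops Y3 (perp (range A)) \<and>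
      represents (row_op A B)
        [X1 \<times> {0}, X2 \<times> {0}, X3 \<times> {0}, {0} \<times> Y3, {0} \<times> Y2, {0} \<times> Y1]
        [perp (range A), perp (range B), M]
        [[\<lambda>_. 0, \<lambda>_. 0,   \<lambda>_. 0,   B3 \<circ> snd, \<lambda>_. 0,   \<lambda>_. 0],
         [\<lambda>_. 0, \<lambda>_. 0,   A3 \<circ> fst, \<lambda>_. 0,   \<lambda>_. 0,   \<lambda>_. 0],
         [\<lambda>_. 0, A2 \<circ> fst, A0 \<circ> fst, B0 \<circ> snd, B2 \<circ> snd, \<lambda>_. 0]]"
  shows "(\<exists>V. direct_sum V (perp (range A)) (perp (range B)) \<and> orthogonal_sum UNIV [V, M]) \<and>
    orthogonal_sum UNIV
      [X1 \<times> {0}, X2 \<times> {0}, X3 \<times> {0}, {0} \<times> Y3, {0} \<times> Y2, {0} \<times> Y1] \<and>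
    (\<exists>A0 A2 A3 B0 B2 B3. rep A0 A2 A3 B0 B2 B3) \<and>
    (\<forall>A0 A2 A3 B0 B2 B3. rep A0 A2 A3 B0 B2 B3 \<longrightarrow>
      isomorphism_on X3 (perp (range B)) A3 \<and>
      isomorphism_on Y3 (perp (range A)) B3 \<and>
      right_invertible_on (X2 \<times> Y2) M (row_op A2 B2) \<and>
      closure (A2 ` X2) = M \<and> M = closure (B2 ` Y2))"
proof -
  obtain G where G: "G \<in> bounded_ops UNIV UNIV" and AG: "\<And>z. row_op A B (G z) = z"
    using assms(5) unfolding right_invertible_on_def by blast
  interpret P: right_inverse_pair A B "fst \<circ> G" "snd \<circ> G"
  proof
    \<comment> \<open>With the target written as a product, \<open>fst_bounded_ops\<close> and
      \<open>snd_bounded_ops\<close> apply.\<close>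
    have "G \<in> bounded_ops UNIV (UNIV \<times> UNIV)" using G by simp
    then show "fst \<circ> G \<in> bounded_ops UNIV UNIV" "snd \<circ> G \<in> bounded_ops UNIV UNIV"
      by (rule bounded_ops_comp, intro fst_bounded_ops snd_bounded_ops)+
    show "A ((fst \<circ> G) z) + B ((snd \<circ> G) z) = z" for z
      using AG[of z] by (simp add: row_op_def split_beta)
  qed (use assms in auto)
  \<comment> \<open>The exchanged instance supplies the statements about \<open>B\<close> and the
    spaces \<open>Y1\<close>, \<open>Y2\<close>, \<open>Y3\<close>.\<close>
  interpret Q: right_inverse_pair B A "snd \<circ> G" "fst \<circ> G" by (rule P.swap)
  \<comment> \<open>The two instances form the intersection in opposite orders.\<close>
  have M: "M = P.M" "M = Q.M" by (auto simp: M_def)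
  have X: "X1 = kernel A" "X2 = P.X2" "X3 = perp P.K"
    and Y: "Y1 = kernel B" "Y2 = Q.X2" "Y3 = perp Q.K"
    by (simp_all add: X1_def X2_def X3_def Y1_def Y2_def Y3_def)
  have M_sub: "csubspace M" "closed M" using P.csubspace_M by (simp_all add: M closed_Int)
  let ?Ss = "[X1 \<times> {0}, X2 \<times> {0}, X3 \<times> {0}, {0} \<times> Y3, {0} \<times> Y2, {0} \<times> Y1]"
  let ?Ws = "[perp (range A), perp (range B), M]"
  have sums: "orthogonal_sum UNIV ?Ss"
    unfolding X Y by (intro orthogonal_sum_prod P.domain_decomposition Q.domain_decomposition)
  have Ss: "\<forall>S\<in>set ?Ss. csubspace S"
    using sums unfolding orthogonal_sum_def by blast
  have Ws: "\<forall>W\<in>set ?Ws. csubspace W \<and> closed W"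
    by (simp add: M_sub csubspace_perp closed_perp)
  have T: "row_op A B \<in> bounded_ops UNIV UNIV"
    using assms(5) unfolding right_invertible_on_def by blast
  have AX2: "A x \<in> M" if "x \<in> X2" for x
    using that P.A_K unfolding X P.X2_eq M by blast
  have BY2: "B y \<in> M" if "y \<in> Y2" for y
    using that Q.A_K unfolding Y Q.X2_eq M(2) by blast
  have AX1: "A x = 0" if "x \<in> X1" for x using that by (simp add: X1_def kernel_def)
  have BY1: "B y = 0" if "y \<in> Y1" for y using that by (simp add: Y1_def kernel_def)
  have projA0: "proj (perp (range B)) (A x) = 0" if "x \<in> X2" for x
    using AX2[OF that] by (simp add: P.proj_perp_range_eq_0_iff M)
  have projB0: "proj (perp (range A)) (B y) = 0" if "y \<in> Y2" for y
    using BY2[OF that] by (simp add: Q.proj_perp_range_eq_0_iff M)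
  have zeros: "A 0 = 0" "B 0 = 0" "proj M 0 = 0"
    "proj (perp (range A)) 0 = 0" "proj (perp (range B)) 0 = 0"
    by (simp_all add: bounded_ops_0[OF P.A] bounded_ops_0[OF P.B] proj_id[OF M_sub]
        proj_id[OF csubspace_perp closed_perp] complex_vector.subspace_0 M_sub csubspace_perp)
  \<comment> \<open>The zero entries hold automatically: \<open>X1\<close> and \<open>Y1\<close> are
    kernels, the first two row projections annihilate the ranges of \<open>A\<close> and
    \<open>B\<close> respectively, and \<open>X2\<close>, \<open>Y2\<close> are mapped into
    \<open>M\<close>. As \<open>proj M\<close> is the identity on \<open>M\<close>, the entries
    \<open>A2\<close> and \<open>B2\<close> are restrictions of \<open>A\<close> and
    \<open>B\<close>.\<close>
  have rep_iff: "rep A0 A2 A3 B0 B2 B3 \<longleftrightarrow>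
      A0 \<in> bounded_ops X3 M \<and> A2 \<in> bounded_ops X2 M \<and> A3 \<in> bounded_ops X3 (perp (range B)) \<and>
      B0 \<in> bounded_ops Y3 M \<and> B2 \<in> bounded_ops Y2 M \<and> B3 \<in> bounded_ops Y3 (perp (range A)) \<and>
      (\<forall>x\<in>X3. A0 x = proj M (A x) \<and> A3 x = proj (perp (range B)) (A x)) \<and> (\<forall>x\<in>X2. A2 x = A x) \<and>
      (\<forall>y\<in>Y3. B0 y = proj M (B y) \<and> B3 y = proj (perp (range A)) (B y)) \<and> (\<forall>y\<in>Y2. B2 y = B y)"
    for A0 A2 A3 B0 B2 B3
  proof -
    have entries: "f \<circ> fst \<in> bounded_ops (S \<times> {0}) U" if "f \<in> bounded_ops S U" for f :: "'a \<Rightarrow> 'a" and S U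
      using fst_bounded_ops that by (rule bounded_ops_comp)
    have entries': "f \<circ> snd \<in> bounded_ops ({0} \<times> S) U" if "f \<in> bounded_ops S U" for f :: "'b \<Rightarrow> 'a" and S U
      using snd_bounded_ops that by (rule bounded_ops_comp)
    show ?thesis
      unfolding rep_def represents_iff[OF Ss Ws T] list.size add_0 add_Suc_right add_0_right All_less_Suc
        nth_Cons_0 nth_Cons_Suc
      by (simp add: zero_bounded_ops csubspace_perp M_sub row_op_def
          zeros AX1 BY1 projA0 projB0 P.proj_perp_range Q.proj_perp_range
          proj_id[OF M_sub AX2] proj_id[OF M_sub BY2] cong: conj_cong)
        (blast intro: entries entries')
  qed
  have "\<exists>A0 A2 A3 B0 B2 B3. rep A0 A2 A3 B0 B2 B3"
  proof -
    \<comment> \<open>The witnesses are the compressions; on \<open>X2\<close> and \<open>Y2\<close>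
      the operators themselves already take values in \<open>M\<close>.\<close>
    have "rep (proj M \<circ> A) A (proj (perp (range B)) \<circ> A) (proj M \<circ> B) B (proj (perp (range A)) \<circ> B)"
      unfolding rep_iff
      by (auto intro!: proj_comp_bounded_ops P.A P.B M_sub csubspace_perp closed_perp
          bounded_ops_mono[OF P.A] bounded_ops_mono[OF P.B] AX2 BY2)
    then show ?thesis by blast
  qed
  moreover have "isomorphism_on X3 (perp (range B)) A3 \<and> isomorphism_on Y3 (perp (range A)) B3 \<and>
      right_invertible_on (X2 \<times> Y2) M (row_op A2 B2) \<and>
      closure (A2 ` X2) = M \<and> M = closure (B2 ` Y2)"
    if "rep A0 A2 A3 B0 B2 B3" for A0 A2 A3 B0 B2 B3
  proof (intro conjI)
    note r = that[unfolded rep_iff]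
    show "isomorphism_on X3 (perp (range B)) A3"
      using r unfolding X by (intro P.isomorphism_on_perp_K) auto
    show "isomorphism_on Y3 (perp (range A)) B3"
      using r unfolding Y by (intro Q.isomorphism_on_perp_K) auto
    have "A2 ` X2 = A ` X2" "B2 ` Y2 = B ` Y2" using r by (auto intro!: image_cong)
    then show "closure (A2 ` X2) = M" "M = closure (B2 ` Y2)"
      using P.closure_image_X2 Q.closure_image_X2 by (simp_all add: X Y M Int_commute)
    show "right_invertible_on (X2 \<times> Y2) M (row_op A2 B2)"
      unfolding right_invertible_on_def
    proof (intro conjI bexI ballI)
      show "row_op A2 B2 \<in> bounded_ops (X2 \<times> Y2) M"
        using r M_sub(1) by (intro row_op_bounded_ops) auto
      have sub: "csubspace X2" "closed X2" "csubspace Y2" "closed Y2"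
        unfolding X Y by (rule P.csubspace_X2 P.closed_X2 Q.csubspace_X2 Q.closed_X2)+
      \<comment> \<open>The components of \<open>G\<close> map \<open>M\<close> into
        \<open>P.K\<close> and \<open>Q.K\<close>; on these, projecting onto \<open>X2\<close> and
        \<open>Y2\<close> does not change the images under \<open>A\<close> and \<open>B\<close>, so
        \<open>?g\<close> inherits the right inverse property from \<open>G\<close>.\<close>
      let ?g = "\<lambda>m. ((proj X2 \<circ> (fst \<circ> G)) m, (proj Y2 \<circ> (snd \<circ> G)) m)"
      show "?g \<in> bounded_ops M (X2 \<times> Y2)"
        by (intro Pair_bounded_ops proj_comp_bounded_ops P.C P.D sub)
      show "row_op A2 B2 (?g m) = m" if m: "m \<in> M" for m
      proof -
        have "row_op A2 B2 (?g m)
            = A (proj X2 ((fst \<circ> G) m)) + B (proj Y2 ((snd \<circ> G) m))"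
          using r proj_in[OF sub(1,2)] proj_in[OF sub(3,4)] by (simp add: row_op_def)
        also have "\<dots> = A ((fst \<circ> G) m) + B ((snd \<circ> G) m)"
          unfolding X Y using P.A_proj_X2[OF P.C_M] Q.A_proj_X2[OF Q.C_M] m M by simp
        also have "\<dots> = m" by (rule P.right_inverse)
        finally show ?thesis .
      qed
    qed
  qed
  moreover have "\<exists>V. direct_sum V (perp (range A)) (perp (range B)) \<and> orthogonal_sum UNIV [V, M]"
    using P.codomain_decomposition unfolding M by blast
  ultimately show ?thesis using sums by blast
qed

end
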